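(* Let $\mathcal H$ be a Euclidean space or a real separable Hilbert space, let $n\ge m\ge 2$ be integers, let $\theta\in\mathcal H$, and let $f:\mathcal H\to\mathbb R$ be $m$ times Fréchet differentiable at $\theta$, with derivatives $f^{(k)}(\theta)$, $1\le k\le m$, that are symmetric $k$-linear forms of finite spectral norm. Let $x_1,\dots,x_n\in\mathcal H$ and put $\varepsilon_j=x_j-\theta$, $\bar x=n^{-1}\sum_{j=1}^n x_j$, $\bar\varepsilon=n^{-1}\sum_{j=1}^n\varepsilon_j=\bar x-\theta$. Define $$\widehat f:=f(\bar x)+\sum_{k=1}^m\frac{\langle f^{(k)}(\bar x),\bar u^{(k)}\rangle_k}{k!},\qquad \bar u^{(k)}:=\sum_{1\le j_1\neq\cdots\neq j_k\le n}\frac{(x_{j_1}-\bar x)\otimes\cdots\otimes(x_{j_k}-\bar x)}{n(n-1)\cdots(n-k+1)},$$ $$\bar\varepsilon^{(k)}:=\sum_{1\le j_1\neq\cdots\neq j_k\le n}\frac{\varepsilon_{j_1}\otimes\cdots\otimes\varepsilon_{j_k}}{n(n-1)\cdots(n-k+1)}.$$ Then $$\widehat f=f(\theta)+\sum_{k=1}^m\frac{\langle f^{(k)}(\theta),\bar\varepsilon^{(k)}\rangle_k}{k!}-\mathrm{Rem}_m,$$ where $$\mathrm{Rem}_m:=\sum_{k=0}^m\frac{\langle J^{m-k}\Delta^{(m)},\ \bar\varepsilon^{\otimes(m-k)}\otimes\bar\varepsilon^{(k)}\rangle_m}{(-1)^{m-k}\,k!},\qquad \Delta^{(m)}(t):=f^{(m)}(\bar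 x+t(\theta-\bar x))-f^{(m)}(\bar x),$$ and $J^0h=h(1)$, $J^\alpha h=\frac{1}{\Gamma(\alpha)}\int_0^1h(t)(1-t)^{\alpha-1}\,dt$ for $\alpha>0$ (Riemann–Liouville integral at $1$).
   Context: The $k$-th derivative $f^{(k)}(x)$ is a symmetric $k$-linear form on $\mathcal H$; the spectral norm of a $k$-linear form is $\|T\|_{\rm S}=\sup_{\|h_1\|=\cdots=\|h_k\|=1}|T(h_1,\dots,h_k)|$. The derivatives of $f$ at $\bar x$ and along the segment from $\bar x$ to $\theta$, and the integrals, that appear in the formulas are understood to be well defined. For a continuous $k$-linear form $T$, the pairing with rank-one tensors is $\langle T,v_1\otimes\cdots\otimes v_k\rangle_k=T(v_1,\dots,v_k)$, extended linearly to finite sums of rank-one tensors. The notation $j_1\neq\cdots\neq j_k$ means that the indices are pairwise distinct. Conventions for $k=0$: $\bar\varepsilon^{(0)}=1$ and $\bar\varepsilon^{\otimes 0}=1$ (tensor products with these scalars are trivial). The operator $J^\alpha$ is applied to functions of $t$ with values in $m$-linear forms; $\langle J^\alpha\Delta^{(m)},\tau\rangle_m$ equals $J^\alpha$ applied to the scalar function $t\mapsto\langle\Delta^{(m)}(t),\tau\rangle_m$. *)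

theory Defs
  imports "HOL-Analysis.Analysis" "HOL-Library.Poly_Mapping"
begin

section \<open>Multilinear forms of variable degree\<close>

text \<open>
  The degree \<open>k\<close> of a form varies inside the statement, so a \<open>k\<close>-linear form is a function on
  lists, of which only the values on lists of length \<open>k\<close> matter.
\<close>

definition multilinear_form :: "nat \<Rightarrow> ('a::real_vector list \<Rightarrow> real) \<Rightarrow> bool" where
  "multilinear_form k T \<longleftrightarrow>
     (\<forall>hs i. length hs = k \<longrightarrow> i < k \<longrightarrow> linear (\<lambda>h. T (hs[i := h])))"

definition symmetric_form :: "nat \<Rightarrow> ('a list \<Rightarrow> real) \<Rightarrow> bool" where
  "symmetric_form k T \<longleftrightarrow>
     (\<forall>hs hs'. length hs = k \<longrightarrow> mset hs' = mset hs \<longrightarrow> T hs' = T hs)"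

text \<open>
  The supremum is taken in \<open>ennreal\<close>: it is \<open>\<infinity>\<close> for unbounded forms, and \<open>0\<close> when the space
  is trivial and has no unit vectors.
\<close>

definition spectral_norm :: "nat \<Rightarrow> ('a::real_normed_vector list \<Rightarrow> real) \<Rightarrow> ennreal" where
  "spectral_norm k T =
     (SUP hs \<in> {hs. length hs = k \<and> (\<forall>h\<in>set hs. norm h = 1)}. ennreal \<bar>T hs\<bar>)"


section \<open>Higher Frechet derivatives\<close>

text \<open>
  Frechet derivative at \<open>x\<close> of a map \<open>F\<close> into the \<open>k\<close>-linear forms with the spectral norm. The
  derivative, a bounded linear map \<open>L\<close> into the \<open>k\<close>-linear forms, is identified with the
  bounded \<open>(k+1)\<close>-linear form \<open>T (h # hs) = L h hs\<close>; the direction of differentiation comes first.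
\<close>

definition has_form_derivative ::
  "nat \<Rightarrow> ('a::real_normed_vector \<Rightarrow> 'a list \<Rightarrow> real) \<Rightarrow> ('a list \<Rightarrow> real) \<Rightarrow> 'a \<Rightarrow> bool" where
  "has_form_derivative k F T x \<longleftrightarrow>
     multilinear_form (Suc k) T \<and> spectral_norm (Suc k) T < \<infinity> \<and>
     (\<forall>e>0. \<exists>d>0. \<forall>h. norm h < d \<longrightarrow>
        spectral_norm k (\<lambda>hs. F (x + h) hs - F x hs - T (h # hs)) \<le> ennreal (e * norm h))"

text \<open>
  As with \<^const>\<open>frechet_derivative\<close>, the value is meaningful only where the derivative exists;
  there it is unique on lists of length \<open>k\<close>.
\<close>

primrec nth_frechet ::
  "nat \<Rightarrow> ('a::real_normed_vector \<Rightarrow> real) \<Rightarrow> 'a \<Rightarrow> 'a list \<Rightarrow> real" where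
  "nth_frechet 0 f = (\<lambda>x hs. f x)"
| "nth_frechet (Suc k) f = (\<lambda>x. SOME T. has_form_derivative k (nth_frechet k f) T x)"

text \<open>
  Existence of the \<open>(k+1)\<close>-st derivative at a point includes, as usual, existence of the \<open>k\<close>-th
  derivative in a neighbourhood of that point.
\<close>

primrec times_frechet_differentiable ::
  "nat \<Rightarrow> ('a::real_normed_vector \<Rightarrow> real) \<Rightarrow> 'a \<Rightarrow> bool" where
  "times_frechet_differentiable 0 f = (\<lambda>x. True)"
| "times_frechet_differentiable (Suc k) f = (\<lambda>x.
     eventually (times_frechet_differentiable k f) (nhds x) \<and>
     (\<exists>T. has_form_derivative k (nth_frechet k f) T x))"


section \<open>Tensors\<close>

text \<open>
  Finite sums of rank-one tensors are written as finitely supported coefficient functions on tuples: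
  \<open>Poly_Mapping.single [v\<^sub>1, \<dots>, v\<^sub>k] c\<close> stands for \<open>c\<close> times the rank-one tensor of
  \<open>v\<^sub>1, \<dots>, v\<^sub>k\<close>, and \<open>Poly_Mapping.single [] 1\<close> is the scalar \<open>1\<close>. Distinct coefficient
  functions may represent the same tensor, but they then have the same pairing with every
  multilinear form.
\<close>

type_synonym 'a tensor = "'a list \<Rightarrow>\<^sub>0 real"

definition tensor_prod :: "'a tensor \<Rightarrow> 'a tensor \<Rightarrow> 'a tensor" where
  "tensor_prod s t =
     (\<Sum>u\<in>Poly_Mapping.keys s. \<Sum>v\<in>Poly_Mapping.keys t.
        Poly_Mapping.single (u @ v) (Poly_Mapping.lookup s u * Poly_Mapping.lookup t v))"

definition tensor_power :: "'a \<Rightarrow> nat \<Rightarrow> 'a tensor" where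
  "tensor_power v k = Poly_Mapping.single (replicate k v) 1"

definition tensor_pairing :: "('a list \<Rightarrow> real) \<Rightarrow> 'a tensor \<Rightarrow> real" where
  "tensor_pairing T t = (\<Sum>v\<in>Poly_Mapping.keys t. Poly_Mapping.lookup t v * T v)"

text \<open>
  The average of \<open>y j\<^sub>1 \<otimes> \<dots> \<otimes> y j\<^sub>k\<close> over the
  \<open>n (n - 1) \<dots> (n - k + 1)\<close> tuples of pairwise distinct indices in \<open>{1..n}\<close>.
\<close>

definition distinct_average :: "nat \<Rightarrow> (nat \<Rightarrow> 'a) \<Rightarrow> nat \<Rightarrow> 'a tensor" where
  "distinct_average n y k =
     (\<Sum>js | length js = k \<and> distinct js \<and> set js \<subseteq> {1..n}.
        Poly_Mapping.single (map y js) (1 / (\<Prod>i<k. real n - real i)))"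


section \<open>The estimator and its remainder\<close>

text \<open>
  The integral is the Henstock--Kurzweil integral, which agrees with the Lebesgue
  integral for every Lebesgue integrable integrand. For \<open>\<alpha> = 1\<close> the weight is \<open>1\<close> on
  \<open>{0..<1}\<close>; that \<open>0 powr 0 = 0\<close> at the endpoint does not affect the integral.
\<close>

definition RL_integrand :: "real \<Rightarrow> (real \<Rightarrow> real) \<Rightarrow> real \<Rightarrow> real" where
  "RL_integrand \<alpha> h t = h t * (1 - t) powr (\<alpha> - 1)"

definition RL_integral :: "real \<Rightarrow> (real \<Rightarrow> real) \<Rightarrow> real" where
  "RL_integral \<alpha> h =
     (if \<alpha> = 0 then h 1 else 1 / Gamma \<alpha> * integral {0..1} (RL_integrand \<alpha> h))"

definition sample_mean :: "nat \<Rightarrow> (nat \<Rightarrow> 'a::real_vector) \<Rightarrow> 'a" where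
  "sample_mean n x = (1 / real n) *\<^sub>R (\<Sum>j=1..n. x j)"

definition f_hat :: "nat \<Rightarrow> nat \<Rightarrow> ('a::real_normed_vector \<Rightarrow> real) \<Rightarrow> (nat \<Rightarrow> 'a) \<Rightarrow> real" where
  "f_hat m n f x =
     f (sample_mean n x) +
     (\<Sum>k=1..m. tensor_pairing (nth_frechet k f (sample_mean n x))
                  (distinct_average n (\<lambda>j. x j - sample_mean n x) k) / fact k)"

definition Delta ::
  "nat \<Rightarrow> nat \<Rightarrow> ('a::real_normed_vector \<Rightarrow> real) \<Rightarrow> 'a \<Rightarrow> (nat \<Rightarrow> 'a) \<Rightarrow> real \<Rightarrow> 'a list \<Rightarrow> real" where
  "Delta m n f \<theta> x t hs =
     nth_frechet m f (sample_mean n x + t *\<^sub>R (\<theta> - sample_mean n x)) hs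
       - nth_frechet m f (sample_mean n x) hs"

definition rem_tensor ::
  "nat \<Rightarrow> nat \<Rightarrow> 'a::real_vector \<Rightarrow> (nat \<Rightarrow> 'a) \<Rightarrow> nat \<Rightarrow> 'a tensor" where
  "rem_tensor m n \<theta> x k =
     tensor_prod (tensor_power (sample_mean n (\<lambda>j. x j - \<theta>)) (m - k))
                 (distinct_average n (\<lambda>j. x j - \<theta>) k)"

definition Rem ::
  "nat \<Rightarrow> nat \<Rightarrow> ('a::real_normed_vector \<Rightarrow> real) \<Rightarrow> 'a \<Rightarrow> (nat \<Rightarrow> 'a) \<Rightarrow> real" where
  "Rem m n f \<theta> x =
     (\<Sum>k=0..m. RL_integral (real (m - k))
                  (\<lambda>t. tensor_pairing (Delta m n f \<theta> x t) (rem_tensor m n \<theta> x k))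
                / ((- 1) ^ (m - k) * fact k))"

end

theory Submission
  imports Defs
begin

text \<open>
  Write \<open>a\<close> for the sample mean, \<open>d = \<theta> - a\<close> and \<open>\<epsilon>\<^sub>j = x\<^sub>j - \<theta>\<close>, so that \<open>x\<^sub>j - a = \<epsilon>\<^sub>j + d\<close>. By
  symmetry of the derivatives at \<open>a\<close>, the average of order \<open>k\<close> in the estimator expands binomially
  into \<open>D\<^sup>kf(a)\<close> paired with \<open>k - i\<close> factors \<open>d\<close> and the average of order \<open>i\<close> of the \<open>\<epsilon>\<^sub>j\<close>. For fixed
  \<open>i\<close>, these terms are the Taylor coefficients at \<open>t = 0\<close> of the pairing of \<open>D\<^sup>if(a + td)\<close> with
  the average of order \<open>i\<close>. Taylor's formula at \<open>t = 1\<close>, with its integral remainder centred at the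
  top derivative at \<open>0\<close>, then gives the \<open>i\<close>-th summand of the remainder.
\<close>

section \<open>Multilinear forms\<close>

lemma multilinear_form_linear:
  assumes "multilinear_form k T" "length xs + Suc (length ys) = k"
  shows "linear (\<lambda>h. T (xs @ h # ys))"
proof -
  have "length (xs @ 0 # ys) = k" "length xs < k" using assms(2) by auto
  then have "linear (\<lambda>h. T ((xs @ 0 # ys)[length xs := h]))"
    using assms(1) unfolding multilinear_form_def by blast
  then show ?thesis by simp
qed

text \<open>Scalars are pulled out from the right end of the scaled block, each freed vector joining
  the arbitrary tail \<open>ys\<close>. Separate \<open>c\<close> and \<open>g\<close> serve both
  normalisation (\<open>norm\<close> and \<open>sgn\<close>) and sign changes.\<close>

lemma multilinear_form_scale:
  assumes "multilinear_form k T" "length xs + length ys = k"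
  shows "T (map (\<lambda>h. c h *\<^sub>R g h) xs @ ys) = prod_list (map c xs) * T (map g xs @ ys)"
  using assms(2)
proof (induction xs arbitrary: ys rule: rev_induct)
  case Nil
  then show ?case by simp
next
  case (snoc x xs)
  let ?A = "map (\<lambda>h. c h *\<^sub>R g h) xs"
  have "linear (\<lambda>h. T (?A @ h # ys))"
    by (rule multilinear_form_linear[OF assms(1)]) (use snoc.prems in simp)
  from linear_scale[OF this, of "c x" "g x"]
  have "T (?A @ (c x *\<^sub>R g x) # ys) = c x * T (?A @ g x # ys)" by simp
  also have "T (?A @ g x # ys) = prod_list (map c xs) * T (map g xs @ g x # ys)"
    by (rule snoc.IH) (use snoc.prems in simp)
  finally show ?case by simp
qed

lemma multilinear_form_replicate_uminus:
  assumes "multilinear_form k T" "p + length ys = k"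
  shows "T (replicate p (- v) @ ys) = (- 1) ^ p * T (replicate p v @ ys)"
  using multilinear_form_scale[OF assms(1), where xs = "replicate p v" and ys = ys
      and c = "\<lambda>_. - 1" and g = "\<lambda>h. h"] assms(2)
  by simp

lemma multilinear_form_diff:
  assumes "multilinear_form k S" "multilinear_form k T"
  shows "multilinear_form k (\<lambda>hs. S hs - T hs)"
  using assms unfolding multilinear_form_def by (auto intro: linear_compose_sub)

lemma multilinear_form_Cons:
  assumes "multilinear_form (Suc k) T"
  shows "multilinear_form k (\<lambda>hs. T (h # hs))"
  unfolding multilinear_form_def
proof (intro allI impI)
  fix hs :: "'a list" and i
  assume "length hs = k" "i < k"
  then have "linear (\<lambda>v. T ((h # hs)[Suc i := v]))"
    using assms unfolding multilinear_form_def by (metis Suc_less_eq length_Cons)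
  then show "linear (\<lambda>v. T (h # hs[i := v]))" by simp
qed

text \<open>Rescaling every argument to \<open>sgn\<close> reduces the bound to unit vectors, the
  only ones the supremum sees. A zero argument is treated apart, since its \<open>sgn\<close> is not
  a unit vector; there the form vanishes.\<close>

lemma multilinear_form_bound:
  fixes T :: "'a::real_normed_vector list \<Rightarrow> real"
  assumes ml: "multilinear_form k T" and len: "length hs = k"
    and le: "spectral_norm k T \<le> ennreal C" and "0 \<le> C"
  shows "\<bar>T hs\<bar> \<le> C * prod_list (map norm hs)"
proof (cases "0 \<in> set hs")
  case True
  then obtain xs ys where hs: "hs = xs @ 0 # ys" by (meson split_list)
  have "linear (\<lambda>h. T (xs @ h # ys))"
    by (rule multilinear_form_linear[OF ml]) (use hs len in simp)
  from linear_0[OF this] show ?thesis using hs by simp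
next
  case False
  have "ennreal \<bar>T (map sgn hs)\<bar> \<le> spectral_norm k T"
    unfolding spectral_norm_def by (rule SUP_upper) (use False len in \<open>auto simp: norm_sgn\<close>)
  with le have "ennreal \<bar>T (map sgn hs)\<bar> \<le> ennreal C" by (rule order_trans[rotated])
  then have b: "\<bar>T (map sgn hs)\<bar> \<le> C" using \<open>0 \<le> C\<close> by (simp add: ennreal_le_iff)
  have nn: "0 \<le> prod_list (map norm hs)" by (induction hs) auto
  have "map (\<lambda>h. norm h *\<^sub>R sgn h) hs = hs"
    by (rule map_idI) (use False in \<open>metis sgn_div_norm divideR_right norm_eq_zero\<close>)
  then have "T hs = prod_list (map norm hs) * T (map sgn hs)"
    using multilinear_form_scale[OF ml, of hs "[]" norm sgn] len by simp
  then show ?thesis using mult_left_mono[OF b nn] nn by (simp add: abs_mult mult.commute)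
qed

text \<open>Evaluation at a fixed \<open>hs\<close> is a bounded functional on multilinear forms, so
  it commutes with differentiation. Multilinearity of \<open>F z\<close> near \<open>x\<close> lets
  the spectral norm of the error control its value at arbitrary, not only unit, vectors.\<close>

lemma form_derivative_apply:
  assumes d: "has_form_derivative k F T x"
    and ml: "eventually (\<lambda>z. multilinear_form k (F z)) (nhds x)"
    and len: "length hs = k"
  shows "((\<lambda>z. F z hs) has_derivative (\<lambda>h. T (h # hs))) (at x)"
  unfolding has_derivative_at_alt
proof (intro conjI allI impI)
  define P where "P = prod_list (map norm hs)"
  have P: "0 \<le> P" unfolding P_def by (induction hs) auto
  have mlT: "multilinear_form (Suc k) T" and fin: "spectral_norm (Suc k) T < \<infinity>"
    using d by (auto simp: has_form_derivative_def)
  from fin obtain C where C: "0 \<le> C" "spectral_norm (Suc k) T = ennreal C"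
    by (cases "spectral_norm (Suc k) T") auto
  have lin: "linear (\<lambda>h. T (h # hs))"
    using multilinear_form_linear[OF mlT, of "[]" hs] len by simp
  show "bounded_linear (\<lambda>h. T (h # hs))"
  proof (rule bounded_linear_intro[of _ "C * P"])
    show "norm (T (h # hs)) \<le> norm h * (C * P)" for h
      using multilinear_form_bound[OF mlT, of "h # hs" C] C len
      by (simp add: P_def mult_ac)
  qed (use linear_add[OF lin] linear_scale[OF lin] in auto)
  fix e :: real assume "0 < e"
  \<comment> \<open>The product \<open>P\<close> may be zero; dividing by \<open>P + 1\<close> still
    gives \<open>e' * P \<le> e\<close>.\<close>
  define e' where "e' = e / (P + 1)"
  have e': "0 < e'" using \<open>0 < e\<close> P by (simp add: e'_def)
  from ml obtain r where r: "0 < r" "\<And>z. dist z x < r \<Longrightarrow> multilinear_form k (F z)"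
    unfolding eventually_nhds_metric by blast
  from d e' obtain s where s: "0 < s" "\<And>h. norm h < s \<Longrightarrow>
      spectral_norm k (\<lambda>hs. F (x + h) hs - F x hs - T (h # hs)) \<le> ennreal (e' * norm h)"
    unfolding has_form_derivative_def by blast
  show "\<exists>d>0. \<forall>y. norm (y - x) < d \<longrightarrow>
      norm (F y hs - F x hs - T ((y - x) # hs)) \<le> e * norm (y - x)"
  proof (intro exI[of _ "min r s"] conjI allI impI)
    show "0 < min r s" using r s by simp
    fix y assume y: "norm (y - x) < min r s"
    have "\<bar>F (x + (y - x)) hs - F x hs - T ((y - x) # hs)\<bar> \<le> e' * norm (y - x) * prod_list (map norm hs)"
    proof (rule multilinear_form_bound)
      show "multilinear_form k (\<lambda>hs. F (x + (y - x)) hs - F x hs - T ((y - x) # hs))"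
        using r y by (intro multilinear_form_diff multilinear_form_Cons mlT) (auto simp: dist_norm)
    qed (use s(2)[of "y - x"] y e' len in simp_all)
    also have "\<dots> = e' * P * norm (y - x)" by (simp add: P_def)
    also have "\<dots> \<le> e * norm (y - x)"
      using P \<open>0 < e\<close> by (intro mult_right_mono) (auto simp: e'_def field_simps)
    finally show "norm (F y hs - F x hs - T ((y - x) # hs)) \<le> e * norm (y - x)" by simp
  qed
qed

section \<open>Symmetry of higher derivatives\<close>

lemma has_real_derivative_along_line:
  fixes \<phi> :: "'a::real_normed_vector \<Rightarrow> real"
  assumes "(\<phi> has_derivative D) (at (c + t *\<^sub>R v))"
  shows "((\<lambda>t. \<phi> (c + t *\<^sub>R v)) has_real_derivative D v) (at t within S)"
proof -
  have "((\<lambda>t. c + t *\<^sub>R v) has_derivative (\<lambda>t. t *\<^sub>R v)) (at t within S)"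
    by (auto intro!: derivative_eq_intros)
  from has_derivative_compose[OF this assms]
  have "((\<lambda>t. \<phi> (c + t *\<^sub>R v)) has_derivative (\<lambda>t. D (t *\<^sub>R v))) (at t within S)" .
  moreover have "D (t *\<^sub>R v) = D v * t" for t
    using linear_scale[OF has_derivative_linear[OF assms]] by (simp add: mult.commute)
  ultimately show ?thesis by (simp add: has_field_derivative_def)
qed

text \<open>
  The mean value theorem is applied to \<open>t \<mapsto> \<phi>(y + sk + tsh) - \<phi>(y + tsh)\<close>. The second difference is
  symmetric in \<open>h\<close> and \<open>k\<close>, which forces the same of \<open>B\<close> without continuity of the second
  derivative.
\<close>

lemma second_difference_approx:
  fixes \<phi> :: "'a::real_normed_vector \<Rightarrow> real"
  assumes \<phi>: "eventually (\<lambda>z. (\<phi> has_derivative G z) (at z)) (nhds y)"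
    and B: "((\<lambda>z. G z h) has_derivative (\<lambda>u. B u h)) (at y)"
    and "0 < e"
  shows "\<exists>\<delta>>0. \<forall>s. 0 < s \<and> s < \<delta> \<longrightarrow>
    \<bar>\<phi> (y + s *\<^sub>R h + s *\<^sub>R k) - \<phi> (y + s *\<^sub>R h) - \<phi> (y + s *\<^sub>R k) + \<phi> y - s\<^sup>2 * B k h\<bar> \<le> e * s\<^sup>2"
proof -
  \<comment> \<open>The displacements \<open>?v t\<close> and \<open>?w t\<close> have norms adding
    up to at most \<open>s * (K - 1)\<close>, so errors of rate \<open>e / K\<close> total at most
    \<open>e * s\<close>. The extra 1 keeps \<open>K\<close> positive.\<close>
  define K where "K = 2 * norm h + norm k + 1"
  have K: "0 < K" by (simp add: K_def add_nonneg_pos)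
  have eK: "0 < e / K" using K \<open>0 < e\<close> by simp
  from \<phi> obtain r where r: "0 < r" "\<And>z. dist z y < r \<Longrightarrow> (\<phi> has_derivative G z) (at z)"
    unfolding eventually_nhds_metric by blast
  from B eK obtain d where d: "0 < d"
    "\<And>z. norm (z - y) < d \<Longrightarrow> norm (G z h - G y h - B (z - y) h) \<le> e / K * norm (z - y)"
    unfolding has_derivative_at_alt by blast
  have linB: "linear (\<lambda>u. B u h)" by (rule has_derivative_linear[OF B])
  show ?thesis
  proof (intro exI[of _ "min d r / K"] conjI allI impI)
    show "0 < min d r / K" using d r K by simp
    fix s assume s: "0 < s \<and> s < min d r / K"
    then have sK: "s * K < min d r" using K by (simp add: field_simps)
    let ?v = "\<lambda>t. t *\<^sub>R (s *\<^sub>R h)"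
    let ?w = "\<lambda>t. s *\<^sub>R k + t *\<^sub>R (s *\<^sub>R h)"
    have v: "norm (?v t) \<le> s * norm h" if "0 \<le> t" "t \<le> 1" for t
      using that s by (simp add: mult_left_le_one_le)
    have w: "norm (?w t) \<le> s * norm k + s * norm h" if "0 \<le> t" "t \<le> 1" for t
      by (rule norm_triangle_le) (use v[OF that] s in simp)
    have sh: "s * norm h < min d r" and shk: "s * norm k + s * norm h < min d r"
    proof -
      have "0 \<le> s * norm h" "0 \<le> s * norm k" using s by auto
      moreover have "s * K = 2 * (s * norm h) + s * norm k + s" by (simp add: K_def algebra_simps)
      ultimately show "s * norm h < min d r" "s * norm k + s * norm h < min d r"
        using sK s by linarith+
    qed
    have der: "((\<lambda>t. \<phi> ((y + s *\<^sub>R k) + ?v t) - \<phi> (y + ?v t)) has_real_derivative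
        (s * G (y + ?w t) h - s * G (y + ?v t) h)) (at t)" if t: "0 \<le> t" "t \<le> 1" for t
    proof (rule DERIV_diff)
      have 1: "(\<phi> has_derivative G (y + ?w t)) (at (y + ?w t))"
        by (rule r) (use w[OF t] shk in \<open>simp add: dist_norm\<close>)
      have 2: "(\<phi> has_derivative G (y + ?v t)) (at (y + ?v t))"
        by (rule r) (use v[OF t] sh in \<open>simp add: dist_norm\<close>)
      have "G (y + ?w t) (s *\<^sub>R h) = s * G (y + ?w t) h"
        using linear_scale[OF has_derivative_linear[OF 1]] by simp
      then show "((\<lambda>t. \<phi> ((y + s *\<^sub>R k) + ?v t)) has_real_derivative s * G (y + ?w t) h) (at t)"
        using has_real_derivative_along_line[where c = "y + s *\<^sub>R k" and v = "s *\<^sub>R h" and t = t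
            and D = "G (y + ?w t)" and \<phi> = \<phi> and S = UNIV] 1
        by (simp add: add.assoc)
      have "G (y + ?v t) (s *\<^sub>R h) = s * G (y + ?v t) h"
        using linear_scale[OF has_derivative_linear[OF 2]] by simp
      then show "((\<lambda>t. \<phi> (y + ?v t)) has_real_derivative s * G (y + ?v t) h) (at t)"
        using has_real_derivative_along_line[OF 2, of UNIV] by simp
    qed
    obtain t where t: "0 < t" "t < 1"
      and eq: "(\<phi> ((y + s *\<^sub>R k) + ?v 1) - \<phi> (y + ?v 1)) - (\<phi> ((y + s *\<^sub>R k) + ?v 0) - \<phi> (y + ?v 0))
        = (1 - 0) * (s * G (y + ?w t) h - s * G (y + ?v t) h)"
      using MVT2[of 0 1, OF _ der] by force
    have v': "norm (?v t) \<le> s * norm h" and w': "norm (?w t) \<le> s * norm k + s * norm h"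
      using v[of t] w[of t] t by auto
    have "\<bar>G (y + ?v t) h - G y h - B (?v t) h\<bar> \<le> e / K * norm (?v t)"
      using d(2)[of "y + ?v t"] v' sh by simp
    moreover have "e / K * norm (?v t) \<le> e / K * (s * norm h)"
      using v' eK by (intro mult_left_mono) auto
    moreover have "\<bar>G (y + ?w t) h - G y h - B (?w t) h\<bar> \<le> e / K * norm (?w t)"
      using d(2)[of "y + ?w t"] w' shk by simp
    moreover have "e / K * norm (?w t) \<le> e / K * (s * norm k + s * norm h)"
      using w' eK by (intro mult_left_mono) auto
    \<comment> \<open>Both values of \<open>G\<close> are expanded about the same point
      \<open>y\<close>. The term \<open>B (?v t) h\<close> cancels in their difference, leaving
      \<open>s * B k h\<close> whatever the unknown \<open>t\<close> is.\<close>
    moreover have "B (?w t) h = s * B k h + B (?v t) h"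
      using linear_add[OF linB] linear_scale[OF linB, of s k] by simp
    moreover have "e / K * (s * norm h) + e / K * (s * norm k + s * norm h) \<le> e * s"
    proof -
      have "e / K * (s * norm h) + e / K * (s * norm k + s * norm h) = e / K * s * (K - 1)"
        by (simp add: K_def divide_simps, simp add: algebra_simps)
      also have "\<dots> \<le> e / K * s * K" using eK s by (intro mult_left_mono mult_nonneg_nonneg order.strict_implies_order) auto
      finally show ?thesis using K by simp
    qed
    ultimately have main: "\<bar>G (y + ?w t) h - G (y + ?v t) h - s * B k h\<bar> \<le> e * s" by argo
    have "\<phi> (y + s *\<^sub>R h + s *\<^sub>R k) - \<phi> (y + s *\<^sub>R h) - \<phi> (y + s *\<^sub>R k) + \<phi> y - s\<^sup>2 * B k h
        = s * (G (y + ?w t) h - G (y + ?v t) h - s * B k h)"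
      using eq by (simp add: algebra_simps power2_eq_square)
    then have "\<bar>\<phi> (y + s *\<^sub>R h + s *\<^sub>R k) - \<phi> (y + s *\<^sub>R h) - \<phi> (y + s *\<^sub>R k) + \<phi> y - s\<^sup>2 * B k h\<bar>
        = s * \<bar>G (y + ?w t) h - G (y + ?v t) h - s * B k h\<bar>"
      using s by (simp add: abs_mult)
    also have "\<dots> \<le> s * (e * s)" using main s by (intro mult_left_mono) auto
    finally show "\<bar>\<phi> (y + s *\<^sub>R h + s *\<^sub>R k) - \<phi> (y + s *\<^sub>R h) - \<phi> (y + s *\<^sub>R k) + \<phi> y - s\<^sup>2 * B k h\<bar>
        \<le> e * s\<^sup>2" by (simp add: power2_eq_square mult_ac)
  qed
qed

lemma second_derivative_symmetric:
  fixes \<phi> :: "'a::real_normed_vector \<Rightarrow> real"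
  assumes \<phi>: "eventually (\<lambda>z. (\<phi> has_derivative G z) (at z)) (nhds y)"
    and B: "\<And>h. ((\<lambda>z. G z h) has_derivative (\<lambda>u. B u h)) (at y)"
  shows "B h k = B k h"
proof -
  have "\<bar>B h k - B k h\<bar> \<le> e" if "0 < e" for e :: real
  proof -
    have e2: "0 < e / 2" using that by simp
    from second_difference_approx[where h = h and k = k and B = B, OF \<phi> B e2] obtain d1 where d1: "0 < d1"
      "\<And>s. 0 < s \<and> s < d1 \<Longrightarrow> \<bar>\<phi> (y + s *\<^sub>R h + s *\<^sub>R k) - \<phi> (y + s *\<^sub>R h) - \<phi> (y + s *\<^sub>R k) + \<phi> y
        - s\<^sup>2 * B k h\<bar> \<le> e / 2 * s\<^sup>2" by blast
    from second_difference_approx[where h = k and k = h and B = B, OF \<phi> B e2] obtain d2 where d2: "0 < d2"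
      "\<And>s. 0 < s \<and> s < d2 \<Longrightarrow> \<bar>\<phi> (y + s *\<^sub>R k + s *\<^sub>R h) - \<phi> (y + s *\<^sub>R k) - \<phi> (y + s *\<^sub>R h) + \<phi> y
        - s\<^sup>2 * B h k\<bar> \<le> e / 2 * s\<^sup>2" by blast
    define s where "s = min d1 d2 / 2"
    have s: "0 < s" "s < d1" "s < d2" using d1(1) d2(1) by (auto simp: s_def min_def)
    have comm: "y + s *\<^sub>R k + s *\<^sub>R h = y + s *\<^sub>R h + s *\<^sub>R k" by (simp add: add_ac)
    have "\<bar>s\<^sup>2 * B h k - s\<^sup>2 * B k h\<bar> \<le> e / 2 * s\<^sup>2 + e / 2 * s\<^sup>2"
      using d1(2)[of s] d2(2)[of s] s unfolding comm by argo
    then have "s\<^sup>2 * \<bar>B h k - B k h\<bar> \<le> s\<^sup>2 * e"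
      by (simp add: abs_mult mult.commute flip: left_diff_distrib)
    then show ?thesis using s by (simp add: mult_le_cancel_left_pos)
  qed
  then have "\<bar>B h k - B k h\<bar> \<le> 0" by (rule field_le_epsilon[of _ 0, simplified])
  then show ?thesis by simp
qed

section \<open>Iterated derivatives and symmetry by induction on the order\<close>

lemma times_frechet_differentiable_mono:
  assumes "times_frechet_differentiable m f y" "k \<le> m"
  shows "times_frechet_differentiable k f y"
  using assms
proof (induction m arbitrary: y)
  case (Suc m)
  then show ?case
    by (cases "k = Suc m") (auto dest: eventually_nhds_x_imp_x simp: le_Suc_eq)
qed simp

lemma has_form_derivative_nth_frechet:
  assumes "times_frechet_differentiable (Suc k) f y"
  shows "has_form_derivative k (nth_frechet k f) (nth_frechet (Suc k) f y) y"
  proof -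
  have "\<exists>T. has_form_derivative k (nth_frechet k f) T y" using assms by simp
  then show ?thesis unfolding nth_frechet.simps by (rule someI_ex)
qed

lemma multilinear_form_nth_frechet:
  assumes "times_frechet_differentiable k f y"
  shows "multilinear_form k (nth_frechet k f y)"
proof (cases k)
  case 0
  then show ?thesis by (simp add: multilinear_form_def)
next
  case (Suc l)
  then show ?thesis
    using has_form_derivative_nth_frechet[of l f y] assms by (simp add: has_form_derivative_def)
qed

lemma nth_frechet_has_derivative:
  assumes "times_frechet_differentiable (Suc k) f y" "length hs = k"
  shows "((\<lambda>z. nth_frechet k f z hs) has_derivative (\<lambda>h. nth_frechet (Suc k) f y (h # hs))) (at y)"
proof (rule form_derivative_apply[OF has_form_derivative_nth_frechet[OF assms(1)] _ assms(2)])
  have "eventually (times_frechet_differentiable k f) (nhds y)" using assms(1) by simp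
  then show "eventually (\<lambda>z. multilinear_form k (nth_frechet k f z)) (nhds y)"
    by eventually_elim (rule multilinear_form_nth_frechet)
qed

text \<open>Permutations of the tail together with the exchange of the first two entries generate
  all permutations.\<close>

lemma symmetric_form_Suc:
  assumes tail: "\<And>h hs hs'. length hs = k \<Longrightarrow> mset hs' = mset hs \<Longrightarrow> T (h # hs') = T (h # hs)"
    and swap: "\<And>h h' hs. Suc (length hs) = k \<Longrightarrow> T (h # h' # hs) = T (h' # h # hs)"
  shows "symmetric_form (Suc k) T"
  unfolding symmetric_form_def
proof (intro allI impI)
  fix hs hs' :: "'a list"
  assume len: "length hs = Suc k" and eq: "mset hs' = mset hs"
  from len obtain h t where hs: "hs = h # t" "length t = k" by (cases hs) auto
  from eq len have "length hs' = Suc k" by (metis size_mset)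
  then obtain h' t' where hs': "hs' = h' # t'" "length t' = k" by (cases hs') auto
  show "T hs' = T hs"
  proof (cases "h = h'")
    case True
    then show ?thesis using eq hs hs' by (auto intro: tail)
  next
    case False
    have "h' \<in> set (h # t)" using eq hs hs' by (metis list.set_intros(1) set_mset_mset)
    then have "h' \<in> set t" using False by simp
    \<comment> \<open>Without the two heads both lists are rearrangements of \<open>r\<close>: the
      tail of \<open>hs\<close> can be sorted to \<open>h' # r\<close> and that of
      \<open>hs'\<close> to \<open>h # r\<close>, after which one swap suffices.\<close>
    define r where "r = remove1 h' t"
    have t: "mset t = mset (h' # r)" and r: "Suc (length r) = k"
      using \<open>h' \<in> set t\<close> hs(2) using length_pos_if_in_set[of h' t] by (auto simp: r_def length_remove1)
    have "mset t' = mset (h # r)" using eq t hs hs' by (simp add: add_mset_commute)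
    then have "T hs' = T (h' # h # r)" using hs' r by (auto intro: tail)
    also have "\<dots> = T (h # h' # r)" by (rule swap[OF r])
    also have "\<dots> = T hs" using hs r t by (auto intro: tail[symmetric])
    finally show ?thesis .
  qed
qed

text \<open>The binomial expansion takes place at the sample mean, so symmetry is derived at any
  point of differentiability. Tail permutations come from differentiating the identity that the
  induction hypothesis gives near \<open>y\<close>; the swap is symmetry of the second derivative of
  the form two degrees lower, evaluated at fixed arguments.\<close>

lemma symmetric_form_nth_frechet:
  "times_frechet_differentiable k f y \<Longrightarrow> symmetric_form k (nth_frechet k f y)"
proof (induction k arbitrary: y)
  case 0
  then show ?case by (simp add: symmetric_form_def)
next
  case (Suc k)
  have ev: "eventually (times_frechet_differentiable k f) (nhds y)" using Suc.prems by simp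
  show ?case
  proof (rule symmetric_form_Suc)
    fix h and hs hs' :: "'a list"
    assume len: "length hs = k" and eq: "mset hs' = mset hs"
    then have len': "length hs' = k" by (metis size_mset)
    from ev have ev': "eventually (\<lambda>z. nth_frechet k f z hs = nth_frechet k f z hs') (nhds y)"
      by eventually_elim (use Suc.IH len eq in \<open>unfold symmetric_form_def, metis\<close>)
    have "((\<lambda>z. nth_frechet k f z hs') has_derivative (\<lambda>h. nth_frechet (Suc k) f y (h # hs))) (at y)"
      by (rule has_derivative_transform_eventually[OF nth_frechet_has_derivative[OF Suc.prems len]])
        (use ev' eventually_nhds_x_imp_x[OF ev'] in \<open>auto simp: eventually_at_filter elim: eventually_mono\<close>)
    from has_derivative_unique[OF this nth_frechet_has_derivative[OF Suc.prems len']]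
    show "nth_frechet (Suc k) f y (h # hs') = nth_frechet (Suc k) f y (h # hs)" by metis
  next
    fix h h' and hs :: "'a list"
    assume len: "Suc (length hs) = k"
    show "nth_frechet (Suc k) f y (h # h' # hs) = nth_frechet (Suc k) f y (h' # h # hs)"
    proof (rule second_derivative_symmetric[where \<phi> = "\<lambda>z. nth_frechet (length hs) f z hs"
          and G = "\<lambda>z v. nth_frechet k f z (v # hs)" and y = y])
      from ev show "eventually (\<lambda>z. ((\<lambda>z. nth_frechet (length hs) f z hs) has_derivative
          (\<lambda>v. nth_frechet k f z (v # hs))) (at z)) (nhds y)"
        by eventually_elim (use nth_frechet_has_derivative[of "length hs" f _ hs] len in auto)
      show "((\<lambda>z. nth_frechet k f z (v # hs)) has_derivative
          (\<lambda>u. nth_frechet (Suc k) f y (u # v # hs))) (at y)" for v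
        by (rule nth_frechet_has_derivative[OF Suc.prems]) (use len in simp)
    qed
  qed
qed

section \<open>Pairings with averages over distinct indices\<close>

text \<open>Cancellation can shrink the support of a sum, so additivity is proved over a common
  finite superset of the supports.\<close>

lemma tensor_pairing_eq_sum:
  assumes "finite S" "Poly_Mapping.keys t \<subseteq> S"
  shows "tensor_pairing T t = (\<Sum>v\<in>S. Poly_Mapping.lookup t v * T v)"
  unfolding tensor_pairing_def
  by (rule sum.mono_neutral_left) (use assms in \<open>auto simp: in_keys_iff\<close>)

lemma tensor_pairing_add: "tensor_pairing T (s + t) = tensor_pairing T s + tensor_pairing T t"
proof -
  let ?S = "Poly_Mapping.keys s \<union> Poly_Mapping.keys t"
  have "tensor_pairing T u = (\<Sum>v\<in>?S. Poly_Mapping.lookup u v * T v)"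
    if "Poly_Mapping.keys u \<subseteq> ?S" for u
    by (rule tensor_pairing_eq_sum) (use that in auto)
  then show ?thesis
    using Poly_Mapping.keys_add[of s t]
    by (simp add: lookup_add distrib_right sum.distrib)
qed

lemma tensor_pairing_sum: "tensor_pairing T (\<Sum>i\<in>I. t i) = (\<Sum>i\<in>I. tensor_pairing T (t i))"
proof (induction I rule: infinite_finite_induct)
  case (insert i I)
  then show ?case by (simp add: tensor_pairing_add)
qed (simp_all add: tensor_pairing_def)

lemma tensor_pairing_single: "tensor_pairing T (Poly_Mapping.single v c) = c * T v"
  by (subst tensor_pairing_eq_sum[of "{v}"]) auto

lemma tensor_pairing_prod_power:
  "tensor_pairing T (tensor_prod (tensor_power v p) t) = tensor_pairing (\<lambda>hs. T (replicate p v @ hs)) t"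
  unfolding tensor_prod_def tensor_power_def
  by (simp add: tensor_pairing_sum tensor_pairing_single) (simp add: tensor_pairing_def)

lemma tensor_pairing_diff:
  "tensor_pairing (\<lambda>hs. S hs - T hs) t = tensor_pairing S t - tensor_pairing T t"
  by (simp add: tensor_pairing_def right_diff_distrib sum_subtractf)

definition distinct_lists :: "nat \<Rightarrow> nat \<Rightarrow> nat list set" where
  "distinct_lists n k = {js. length js = k \<and> distinct js \<and> set js \<subseteq> {1..n}}"

lemma distinct_lists_0 [simp]: "distinct_lists n 0 = {[]}"
  by (auto simp: distinct_lists_def)

lemma tensor_pairing_distinct_average:
  "tensor_pairing T (distinct_average n y k) =
     (\<Sum>js\<in>distinct_lists n k. T (map y js)) / (\<Prod>i<k. real n - real i)"
  by (simp add: distinct_average_def tensor_pairing_sum tensor_pairing_single distinct_lists_def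
      sum_divide_distrib)

text \<open>Deleting the entry at position \<open>r\<close> while remembering it is a bijection onto
  pairs of a shorter tuple and an index outside it, and each shorter tuple leaves
  \<open>n - k\<close> such indices. This averages out an index on which the summand does not
  depend.\<close>

lemma sum_distinct_lists_remove:
  fixes g :: "nat list \<Rightarrow> real"
  assumes "r \<le> k" "k \<le> n"
  shows "(\<Sum>js\<in>distinct_lists n (Suc k). g (take r js @ drop (Suc r) js))
    = (real n - real k) * (\<Sum>js\<in>distinct_lists n k. g js)"
proof -
  have fin: "finite (distinct_lists n k)"
    unfolding distinct_lists_def
    by (rule finite_subset[OF _ finite_lists_length_eq[of "{1..n}" k]]) auto
  have "(\<Sum>js\<in>distinct_lists n (Suc k). g (take r js @ drop (Suc r) js))
    = (\<Sum>(js, j)\<in>(SIGMA js:distinct_lists n k. {1..n} - set js). g js)"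
  proof (rule sum.reindex_bij_witness[where
        i = "\<lambda>(js, j). take r js @ j # drop r js" and
        j = "\<lambda>js. (take r js @ drop (Suc r) js, js ! r)"])
    fix js assume js: "js \<in> distinct_lists n (Suc k)"
    then have rl: "r < length js" using assms by (simp add: distinct_lists_def)
    have id: "take r js @ js ! r # drop (Suc r) js = js" using rl by (simp add: id_take_nth_drop[symmetric])
    have "distinct (take r js @ js ! r # drop (Suc r) js)"
      and "set (take r js @ js ! r # drop (Suc r) js) \<subseteq> {1..n}"
      unfolding id using js by (auto simp: distinct_lists_def)
    moreover have "length (take r js @ drop (Suc r) js) = k"
      using js assms by (simp add: distinct_lists_def)
    ultimately show "(take r js @ drop (Suc r) js, js ! r) \<in> (SIGMA js:distinct_lists n k. {1..n} - set js)"
      by (auto simp: distinct_lists_def)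
    show "(case (take r js @ drop (Suc r) js, js ! r) of (js, j) \<Rightarrow> take r js @ j # drop r js) = js"
      using rl id by (simp add: min_def)
  next
    fix a assume a: "a \<in> (SIGMA js:distinct_lists n k. {1..n} - set js)"
    then obtain js j where js: "a = (js, j)" "length js = k" "distinct js" "set js \<subseteq> {1..n}"
      "j \<in> {1..n}" "j \<notin> set js" by (auto simp: distinct_lists_def)
    have sub: "set (take r js) \<union> set (drop r js) = set js"
      by (metis append_take_drop_id set_append)
    show "(case a of (js, j) \<Rightarrow> take r js @ j # drop r js) \<in> distinct_lists n (Suc k)"
      using js sub assms by (auto simp: distinct_lists_def set_take_disj_set_drop_if_distinct)
    show "(take r (case a of (js, j) \<Rightarrow> take r js @ j # drop r js) @
        drop (Suc r) (case a of (js, j) \<Rightarrow> take r js @ j # drop r js),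
        (case a of (js, j) \<Rightarrow> take r js @ j # drop r js) ! r) = a"
      using js assms by (simp add: nth_append min_def)
  qed auto
  also have "\<dots> = (\<Sum>js\<in>distinct_lists n k. \<Sum>j\<in>{1..n} - set js. g js)"
    by (subst sum.Sigma) (use fin in auto)
  also have "\<dots> = (\<Sum>js\<in>distinct_lists n k. (real n - real k) * g js)"
  proof (rule sum.cong[OF refl])
    fix js assume "js \<in> distinct_lists n k"
    then have "card ({1..n} - set js) = n - k"
      by (subst card_Diff_subset) (auto simp: distinct_lists_def distinct_card)
    then show "(\<Sum>j\<in>{1..n} - set js. g js) = (real n - real k) * g js"
      using assms by (simp add: of_nat_diff)
  qed
  finally show ?thesis by (simp add: sum_distrib_left)
qed

lemma sum_binomial_Suc:
  fixes a :: "nat \<Rightarrow> real"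
  shows "(\<Sum>i\<le>Suc r. real (Suc r choose i) * a i)
    = (\<Sum>i\<le>r. real (r choose i) * a (Suc i)) + (\<Sum>i\<le>r. real (r choose i) * a i)"
proof -
  have "(\<Sum>i\<le>Suc r. real (Suc r choose i) * a i)
      = a 0 + (\<Sum>i\<le>r. real (r choose i) * a (Suc i) + real (r choose Suc i) * a (Suc i))"
    by (subst sum.atMost_Suc_shift) (simp add: distrib_right)
  \<comment> \<open>Extending the second sum to \<open>Suc r\<close> lets the shift absorb
    \<open>a 0\<close>; the added last term has coefficient \<open>r choose Suc r\<close>, which is
    0.\<close>
  also have "\<dots> = (\<Sum>i\<le>r. real (r choose i) * a (Suc i)) + (\<Sum>i\<le>Suc r. real (r choose i) * a i)"
    unfolding sum.atMost_Suc_shift[of _ r] by (simp add: sum.distrib)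
  finally show ?thesis by simp
qed

text \<open>
  The averages of the forms \<open>T(c, \<dots>, c, u j\<^sub>1, \<dots>, u j\<^sub>r, y j\<^sub>r\<^sub>+\<^sub>1, \<dots>)\<close> with \<open>u = y + c\<close> satisfy
  Pascal's recursion: expanding the last \<open>u\<close> gives either one more \<open>y\<close>, or one more \<open>c\<close> and an
  index that no longer occurs and is averaged out.
\<close>

lemma distinct_average_translate:
  assumes ml: "multilinear_form k T" and sym: "symmetric_form k T" and "k \<le> n"
  shows "tensor_pairing T (distinct_average n (\<lambda>j. y j + c) k) =
    (\<Sum>i\<le>k. real (k choose i) *
       tensor_pairing T (tensor_prod (tensor_power c (k - i)) (distinct_average n y i)))"
proof -
  \<comment> \<open>The slots hold \<open>p\<close> copies of \<open>c\<close>, then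
    \<open>r\<close> translated vectors, then \<open>s\<close> plain ones, with
    \<open>p + r + s = k\<close>. Only \<open>r + s\<close> indices occur, hence the length of the
    normalising product in \<open>W\<close>.\<close>
  define L where "L p r js = replicate p c @ map (\<lambda>j. y j + c) (take r js) @ map y (drop r js)"
    for p r js
  define W where "W p r s = (\<Sum>js\<in>distinct_lists n (r + s). T (L p r js)) /
      (\<Prod>i<r + s. real n - real i)" for p r s
  have rec: "W p (Suc r) s = W p r (Suc s) + W (Suc p) r s" if k: "p + Suc r + s = k" for p r s
  proof -
    define P where "P = (\<Prod>i<r + s. real n - real i)"
    \<comment> \<open>This is the last factor of the normalising product for
      \<open>r + s + 1\<close> indices. It cancels the number of choices for the removed
      index.\<close>
    have pos: "real n - real (r + s) \<noteq> 0" using k \<open>k \<le> n\<close> by simp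
    have "T (L p (Suc r) js) = T (L p r js) + T (L (Suc p) r (take r js @ drop (Suc r) js))"
      if "js \<in> distinct_lists n (Suc (r + s))" for js
    proof -
      let ?A = "replicate p c @ map (\<lambda>j. y j + c) (take r js)"
      let ?B = "map y (drop (Suc r) js)"
      have len: "length js = Suc (r + s)" using that by (simp add: distinct_lists_def)
      then have rl: "r < length js" by simp
      have lin: "linear (\<lambda>h. T (?A @ h # ?B))"
        by (rule multilinear_form_linear[OF ml]) (use k len in simp)
      have "L p (Suc r) js = ?A @ (y (js ! r) + c) # ?B"
        unfolding L_def using rl by (simp add: take_Suc_conv_app_nth)
      then have "T (L p (Suc r) js) = T (?A @ y (js ! r) # ?B) + T (?A @ c # ?B)"
        using linear_add[OF lin] by simp
      moreover have "?A @ y (js ! r) # ?B = L p r js"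
        unfolding L_def using Cons_nth_drop_Suc[OF rl] by (metis append_assoc list.simps(9))
      \<comment> \<open>Symmetry enters here: the new \<open>c\<close> arises after the translated
        vectors and has to join the block of copies at the front.\<close>
      moreover have "T (?A @ c # ?B) = T (L (Suc p) r (take r js @ drop (Suc r) js))"
      proof -
        have "L (Suc p) r (take r js @ drop (Suc r) js) = c # ?A @ ?B"
          unfolding L_def using rl by (simp add: min_def)
        moreover have "length (c # ?A @ ?B) = k" using k len by simp
        moreover have "mset (?A @ c # ?B) = mset (c # ?A @ ?B)" by simp
        ultimately show ?thesis using sym unfolding symmetric_form_def by metis
      qed
      ultimately show ?thesis by simp
    qed
    then have "(\<Sum>js\<in>distinct_lists n (Suc (r + s)). T (L p (Suc r) js)) =
        (\<Sum>js\<in>distinct_lists n (Suc (r + s)). T (L p r js)) +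
        (\<Sum>js\<in>distinct_lists n (Suc (r + s)). T (L (Suc p) r (take r js @ drop (Suc r) js)))"
      by (simp add: sum.distrib)
    also have "(\<Sum>js\<in>distinct_lists n (Suc (r + s)). T (L (Suc p) r (take r js @ drop (Suc r) js)))
        = (real n - real (r + s)) * (\<Sum>js\<in>distinct_lists n (r + s). T (L (Suc p) r js))"
      by (rule sum_distinct_lists_remove) (use k \<open>k \<le> n\<close> in auto)
    finally show ?thesis
      using pos by (simp add: W_def add_divide_distrib)
  qed
  \<comment> \<open>Of the \<open>r\<close> translated slots, \<open>i\<close> become plain and
    \<open>r - i\<close> become \<open>c\<close>; iterating the recursion removes all translated
    slots.\<close>
  have W: "W p r s = (\<Sum>i\<le>r. real (r choose i) * W (p + (r - i)) 0 (s + i))" if "p + r + s = k" for p r s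
    using that
  proof (induction r arbitrary: p s)
    case 0
    then show ?case by simp
  next
    case (Suc r)
    let ?a = "\<lambda>i. W (p + (Suc r - i)) 0 (s + i)"
    have "W p r (Suc s) = (\<Sum>i\<le>r. real (r choose i) * ?a (Suc i))"
      using Suc.IH[of p "Suc s"] Suc.prems by simp
    moreover have "W (Suc p) r s = (\<Sum>i\<le>r. real (r choose i) * ?a i)"
      using Suc.IH[of "Suc p" s] Suc.prems by (simp add: Suc_diff_le)
    ultimately show ?case using rec[of p r s] Suc.prems sum_binomial_Suc[of r ?a] by simp
  qed
  have "tensor_pairing T (distinct_average n (\<lambda>j. y j + c) k) = W 0 k 0"
    unfolding tensor_pairing_distinct_average W_def
    by (auto simp: L_def distinct_lists_def intro!: arg_cong2[where f = divide] sum.cong)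
  moreover have "tensor_pairing T (tensor_prod (tensor_power c p) (distinct_average n y i)) = W p 0 i" for p i
    by (simp add: tensor_pairing_prod_power tensor_pairing_distinct_average W_def L_def)
  ultimately show ?thesis using W[of 0 k 0] by simp
qed

section \<open>Taylor expansion along the segment\<close>

text \<open>The weight has integral \<open>1 / fact p\<close> after normalisation, so centring
  \<open>g p\<close> at 0 moves the Taylor term of order \<open>p\<close> from the remainder into
  the sum. Continuity of \<open>g p\<close> is not assumed: the gauge integral recovers a function
  from any derivative. For \<open>p = 0\<close> the operator is evaluation at 1.\<close>

lemma RL_integral_taylor:
  fixes g :: "nat \<Rightarrow> real \<Rightarrow> real"
  assumes der: "\<And>q t. q < p \<Longrightarrow> 0 \<le> t \<Longrightarrow> t \<le> 1 \<Longrightarrow>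
    (g q has_real_derivative g (Suc q) t) (at t within {0..1})"
  shows "RL_integral (real p) (\<lambda>t. g p t - g p 0) = g 0 1 - (\<Sum>q\<le>p. g q 0 / fact q)"
proof (cases p)
  case 0
  then show ?thesis by (simp add: RL_integral_def)
next
  case (Suc l)
  have 1: "((\<lambda>t. (1 - t) ^ l / fact l * g p t) has_integral g 0 1 - (\<Sum>q<p. g q 0 / fact q)) {0..1}"
    using Taylor_has_integral[of p g "g 0" 0 1] der Suc
    by (simp add: has_real_derivative_iff_has_vector_derivative)
  have 2: "((\<lambda>t. (1 - t) ^ l / fact l * g p 0) has_integral
      (- ((1 - 1) ^ p / fact p * g p 0)) - (- ((1 - 0) ^ p / fact p * g p 0))) {0..1}"
  proof (rule fundamental_theorem_of_calculus)
    fix t :: real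
    have "fact p = (1 + real l) * fact l" using Suc by simp
    then have "(1 + real l) * (1 - t) ^ l / fact p = (1 - t) ^ l / fact l"
      by (simp add: mult_divide_mult_cancel_left_if)
    moreover have "((\<lambda>t. 1 - t) has_real_derivative - 1) (at t within {0..1})"
      by (auto intro!: derivative_eq_intros)
    from DERIV_minus[OF DERIV_cmult_right[OF DERIV_cdivide[OF DERIV_power_Suc[OF this, of l]]]]
    have "((\<lambda>t. - ((1 - t) ^ p / fact p * g p 0)) has_real_derivative
        (1 + real l) * (1 - t) ^ l / fact p * g p 0) (at t within {0..1})"
      unfolding Suc by (simp del: power_Suc fact_Suc)
    ultimately have "((\<lambda>t. - ((1 - t) ^ p / fact p * g p 0)) has_real_derivative
        (1 - t) ^ l / fact l * g p 0) (at t within {0..1})" by simp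
    then show "((\<lambda>t. - ((1 - t) ^ p / fact p * g p 0)) has_vector_derivative (1 - t) ^ l / fact l * g p 0)
      (at t within {0..1})"
      by (simp add: has_real_derivative_iff_has_vector_derivative)
  qed simp
  have "((\<lambda>t. (1 - t) ^ l / fact l * g p t - (1 - t) ^ l / fact l * g p 0) has_integral
      g 0 1 - (\<Sum>q\<le>p. g q 0 / fact q)) {0..1}"
    using has_integral_diff[OF 1 2] Suc by (simp add: lessThan_Suc_atMost[symmetric] algebra_simps)
  from has_integral_mult_right[OF this, of "fact l"]
  have "((\<lambda>t. (1 - t) ^ l * (g p t - g p 0)) has_integral
      fact l * (g 0 1 - (\<Sum>q\<le>p. g q 0 / fact q))) {0..1}"
    by (simp add: right_diff_distrib)
  then have "(RL_integrand (real p) (\<lambda>t. g p t - g p 0) has_integral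
      fact l * (g 0 1 - (\<Sum>q\<le>p. g q 0 / fact q))) {0..1}"
    \<comment> \<open>The real and natural powers can differ only at \<open>t = 1\<close>, and do so
      when \<open>l = 0\<close>, where \<open>0 powr 0 = 0\<close> but
      \<open>0 ^ 0 = 1\<close>.\<close>
    by (rule has_integral_spike_finite[of "{1}", rotated -1])
      (auto simp: RL_integrand_def Suc powr_realpow)
  then show ?thesis
    using Gamma_fact[of l, where ?'a = real] Suc
    by (simp add: RL_integral_def integral_unique add.commute)
qed

lemma RL_integral_cmult: "RL_integral \<alpha> (\<lambda>t. c * h t) = c * RL_integral \<alpha> h"
  by (simp add: RL_integral_def RL_integrand_def[abs_def] mult.assoc)

lemma RL_integral_cong:
  assumes "\<And>t. 0 \<le> t \<Longrightarrow> t \<le> 1 \<Longrightarrow> g t = h t"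
  shows "RL_integral \<alpha> g = RL_integral \<alpha> h"
  using assms by (auto simp: RL_integral_def RL_integrand_def intro!: integral_cong)

text \<open>The direction of differentiation enters as the first argument, so differentiating along
  \<open>d\<close> lengthens the leading block of copies of \<open>d\<close> by one.\<close>

lemma has_real_derivative_tensor_pairing:
  assumes diff: "times_frechet_differentiable (Suc (q + i)) f (a + t *\<^sub>R d)"
  shows "((\<lambda>t. tensor_pairing (nth_frechet (q + i) f (a + t *\<^sub>R d))
        (tensor_prod (tensor_power d q) (distinct_average n y i)))
      has_real_derivative
      tensor_pairing (nth_frechet (Suc q + i) f (a + t *\<^sub>R d))
        (tensor_prod (tensor_power d (Suc q)) (distinct_average n y i))) (at t within S)"
proof -
  have "((\<lambda>t. nth_frechet (q + i) f (a + t *\<^sub>R d) (replicate q d @ map y js)) has_real_derivative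
      nth_frechet (Suc (q + i)) f (a + t *\<^sub>R d) (d # replicate q d @ map y js)) (at t within S)"
    if "js \<in> distinct_lists n i" for js
    by (rule has_real_derivative_along_line[OF nth_frechet_has_derivative[OF diff]])
      (use that in \<open>simp add: distinct_lists_def\<close>)
  then show ?thesis
    unfolding tensor_pairing_prod_power tensor_pairing_distinct_average
    by (intro DERIV_cdivide DERIV_sum) simp
qed

theorem proposition2p1:
  fixes f :: "'a::{real_inner, polish_space} \<Rightarrow> real"
    and \<theta> :: 'a and x :: "nat \<Rightarrow> 'a" and m n :: nat
  assumes "2 \<le> m" and "m \<le> n"
    and "times_frechet_differentiable m f \<theta>"
    and "\<And>k. 1 \<le> k \<Longrightarrow> k \<le> m \<Longrightarrow>
           multilinear_form k (nth_frechet k f \<theta>) \<and>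
           symmetric_form k (nth_frechet k f \<theta>) \<and>
           spectral_norm k (nth_frechet k f \<theta>) < \<infinity>"
    and "\<And>y. y \<in> closed_segment (sample_mean n x) \<theta> \<Longrightarrow> times_frechet_differentiable m f y"
    and "\<And>k. k < m \<Longrightarrow>
           RL_integrand (real (m - k))
             (\<lambda>t. tensor_pairing (Delta m n f \<theta> x t) (rem_tensor m n \<theta> x k))
           integrable_on {0..1}"
  shows "f_hat m n f x =
           f \<theta>
           + (\<Sum>k=1..m. tensor_pairing (nth_frechet k f \<theta>)
                          (distinct_average n (\<lambda>j. x j - \<theta>) k) / fact k)
           - Rem m n f \<theta> x"
proof -
  define a where "a = sample_mean n x"
  define d where "d = \<theta> - a"
  define y where "y j = x j - \<theta>" for j
  \<comment> \<open>By construction \<open>g i q\<close> is the derivative of order \<open>q\<close>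
    of \<open>g i 0\<close> along the segment from \<open>a\<close> to \<theta>.\<close>
  define g where "g i q t = tensor_pairing (nth_frechet (q + i) f (a + t *\<^sub>R d))
        (tensor_prod (tensor_power d q) (distinct_average n y i))" for i q t
  have diff: "times_frechet_differentiable k f (a + t *\<^sub>R d)" if "k \<le> m" "0 \<le> t" "t \<le> 1" for k t
  proof -
    have "a + t *\<^sub>R d \<in> closed_segment a \<theta>"
      unfolding in_segment using that by (intro exI[of _ t]) (auto simp: d_def algebra_simps)
    then show ?thesis
      using assms(5) that(1) times_frechet_differentiable_mono unfolding a_def by blast
  qed
  \<comment> \<open>The mean error is \<open>- d\<close>, so its tensor power of order
    \<open>m - i\<close> differs from that of \<open>d\<close> by exactly the sign that
    \<open>Rem\<close> divides out. The bounds on \<open>m\<close> and \<open>n\<close> ensure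
    \<open>n > 0\<close>.\<close>
  have mean: "sample_mean n y = - d"
    using assms(1,2) unfolding y_def d_def a_def sample_mean_def
    by (simp add: sum_subtractf scaleR_diff_right sum_constant_scaleR)
  have taylor: "RL_integral (real (m - i)) (\<lambda>t. g i (m - i) t - g i (m - i) 0)
      = g i 0 1 - (\<Sum>q\<le>m - i. g i q 0 / fact q)" if "i \<le> m" for i
  proof (rule RL_integral_taylor)
    fix q t assume "q < m - i" "(0::real) \<le> t" "t \<le> 1"
    then show "(g i q has_real_derivative g i (Suc q) t) (at t within {0..1})"
      unfolding g_def by (intro has_real_derivative_tensor_pairing diff) auto
  qed
  have Delta: "tensor_pairing (Delta m n f \<theta> x t) (rem_tensor m n \<theta> x i)
      = (- 1) ^ (m - i) * (g i (m - i) t - g i (m - i) 0)" if "i \<le> m" "0 \<le> t" "t \<le> 1" for i t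
  proof -
    have "tensor_pairing (nth_frechet m f (a + s *\<^sub>R d)) (rem_tensor m n \<theta> x i)
        = (- 1) ^ (m - i) * g i (m - i) s" if s: "0 \<le> s" "s \<le> 1" for s
    proof -
      have "nth_frechet m f (a + s *\<^sub>R d) (replicate (m - i) (- d) @ map y js)
          = (- 1) ^ (m - i) * nth_frechet m f (a + s *\<^sub>R d) (replicate (m - i) d @ map y js)"
        if "js \<in> distinct_lists n i" for js
        by (rule multilinear_form_replicate_uminus[OF multilinear_form_nth_frechet[OF diff]])
          (use \<open>i \<le> m\<close> s that in \<open>auto simp: distinct_lists_def\<close>)
      then show ?thesis
        using \<open>i \<le> m\<close> mean
        by (simp add: g_def rem_tensor_def tensor_pairing_prod_power tensor_pairing_distinct_average
            y_def[abs_def] sum_distrib_left)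
    qed
    from this[of t] this[of 0] show ?thesis
      using that unfolding Delta_def[abs_def] tensor_pairing_diff
      by (simp add: a_def d_def right_diff_distrib)
  qed
  have "Rem m n f \<theta> x = (\<Sum>i\<le>m. (g i 0 1 - (\<Sum>q\<le>m - i. g i q 0 / fact q)) / fact i)"
    unfolding Rem_def atMost_atLeast0[symmetric]
  proof (rule sum.cong[OF refl])
    fix i assume "i \<in> {..m}"
    then have i: "i \<le> m" by simp
    have "RL_integral (real (m - i)) (\<lambda>t. tensor_pairing (Delta m n f \<theta> x t) (rem_tensor m n \<theta> x i))
        = (- 1) ^ (m - i) * (g i 0 1 - (\<Sum>q\<le>m - i. g i q 0 / fact q))"
      unfolding taylor[OF i, symmetric] RL_integral_cmult[symmetric]
      by (rule RL_integral_cong) (rule Delta[OF i])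
    then show "RL_integral (real (m - i))
          (\<lambda>t. tensor_pairing (Delta m n f \<theta> x t) (rem_tensor m n \<theta> x i)) / ((- 1) ^ (m - i) * fact i)
        = (g i 0 1 - (\<Sum>q\<le>m - i. g i q 0 / fact q)) / fact i"
      by simp
  qed
  then have Rem: "Rem m n f \<theta> x = (\<Sum>i\<le>m. g i 0 1 / fact i)
      - (\<Sum>i\<le>m. \<Sum>q\<le>m - i. g i q 0 / (fact i * fact q))"
    by (simp add: diff_divide_distrib sum_subtractf sum_divide_distrib mult.commute)
  have g01: "g i 0 1 = tensor_pairing (nth_frechet i f \<theta>) (distinct_average n y i)" for i
    by (simp add: g_def tensor_pairing_prod_power d_def)
  \<comment> \<open>The empty average is the scalar 1, so the summand \<open>i = 0\<close> is the
    value of \<open>f\<close> itself.\<close>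
  have f\<theta>: "f \<theta> + (\<Sum>k=1..m. tensor_pairing (nth_frechet k f \<theta>) (distinct_average n y k) / fact k)
      = (\<Sum>i\<le>m. g i 0 1 / fact i)"
    unfolding sum.atMost_shift g01[symmetric]
    by (simp add: g01 tensor_pairing_distinct_average sum.atLeast1_atMost_eq)
  \<comment> \<open>Centring at the sample mean translates the errors by \<open>d\<close>, since
    \<open>x j - a = y j + d\<close>.\<close>
  have "f_hat m n f x = (\<Sum>k\<le>m. tensor_pairing (nth_frechet k f a)
      (distinct_average n (\<lambda>j. y j + d) k) / fact k)"
    unfolding f_hat_def sum.atMost_shift a_def[symmetric]
    by (simp add: tensor_pairing_distinct_average sum.atLeast1_atMost_eq y_def d_def)
  also have "\<dots> = (\<Sum>k\<le>m. \<Sum>i\<le>k. g i (k - i) 0 / (fact i * fact (k - i)))"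
  proof (rule sum.cong[OF refl])
    fix k assume "k \<in> {..m}"
    then have k: "times_frechet_differentiable k f a" "k \<le> n"
      using diff[of k 0] assms(2) by auto
    show "tensor_pairing (nth_frechet k f a) (distinct_average n (\<lambda>j. y j + d) k) / fact k
        = (\<Sum>i\<le>k. g i (k - i) 0 / (fact i * fact (k - i)))"
      unfolding distinct_average_translate[OF multilinear_form_nth_frechet[OF k(1)]
          symmetric_form_nth_frechet[OF k(1)] k(2)] sum_divide_distrib
      by (rule sum.cong[OF refl]) (simp add: g_def binomial_fact)
  qed
  \<comment> \<open>With \<open>q = k - i\<close> both orders of summation run over the triangle
    \<open>i + q \<le> m\<close>. The result is the double sum subtracted in
    \<open>Rem\<close>.\<close>
  also have "\<dots> = (\<Sum>i\<le>m. \<Sum>q\<le>m - i. g i q 0 / (fact i * fact q))"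
  proof -
    have "{(i, q). i + q \<le> m} = (SIGMA i:{..m}. {..m - i})" by auto
    then show ?thesis
      using sum.triangle_reindex_eq[of "\<lambda>i q. g i q 0 / (fact i * fact q)" m]
      by (simp add: sum.Sigma)
  qed
  finally show ?thesis using Rem f\<theta> by (simp add: y_def[abs_def])
qed

end
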